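(* Let $K$ be the middle third Cantor set, $\mathcal{W}$ the set of very well approximable real numbers, $\mathcal{L}$ the set of Liouville numbers, and $\gamma=\frac{\log 2}{\log 3}$. Then $$\dim\big((\mathcal{W}\setminus\mathcal{L})\cap K\big)\ \ge\ \gamma/2 .$$ In particular, $(\mathcal{W}\setminus\mathcal{L})\cap K\neq\emptyset$.
   Context: $\dim$ denotes Hausdorff dimension. $K\subset[0,1]$ is the standard middle third Cantor set, and $\gamma=\dim K$. For $\epsilon>0$ consider the condition on a real number $x$: $$(\ast_\epsilon)\qquad |x-p/q|<q^{-(2+\epsilon)}\ \text{ for infinitely many }(p,q)\in\mathbb{Z}\times\mathbb{N}.$$ $x$ is very well approximable if $(\ast_\epsilon)$ holds for some $\epsilon>0$. $x$ is a Liouville number if $(\ast_\epsilon)$ holds for every $\epsilon>0$. *)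

theory Defs
  imports "HOL-Analysis.Analysis"
begin

text \<open>
  The \<open>s\<close>-th power of the diameter, with the usual conventions for \<open>s = 0\<close>: the empty set
  contributes \<open>0\<close> and every nonempty set contributes \<open>1\<close> (note that \<open>0 powr 0 = 0\<close> in HOL).
\<close>
definition diam_pow :: "real \<Rightarrow> 'a::metric_space set \<Rightarrow> ennreal" where
  "diam_pow s U = (if U = {} then 0 else if s = 0 then 1 else ennreal (diameter U powr s))"

text \<open>Boundedness is required because \<^const>\<open>diameter\<close> is only meaningful on bounded sets.\<close>
definition hausdorff_pre :: "real \<Rightarrow> real \<Rightarrow> 'a::metric_space set \<Rightarrow> ennreal" where
  "hausdorff_pre s \<delta> A =
     (INF U \<in> {U :: nat \<Rightarrow> 'a set. A \<subseteq> (\<Union>i. U i) \<and>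
                 (\<forall>i. bounded (U i) \<and> diameter (U i) \<le> \<delta>)}.
        \<Sum>i. diam_pow s (U i))"

definition hausdorff_measure :: "real \<Rightarrow> 'a::metric_space set \<Rightarrow> ennreal" where
  "hausdorff_measure s A = (SUP \<delta> \<in> {0<..}. hausdorff_pre s \<delta> A)"

definition hausdorff_dim :: "'a::metric_space set \<Rightarrow> ereal" where
  "hausdorff_dim A = Inf {ereal s | s. 0 \<le> s \<and> hausdorff_measure s A = 0}"

fun cantor_step :: "nat \<Rightarrow> real set" where
  "cantor_step 0 = {0..1}"
| "cantor_step (Suc n) = (\<lambda>x. x / 3) ` cantor_step n \<union> (\<lambda>x. (x + 2) / 3) ` cantor_step n"

definition cantor_set :: "real set" where
  "cantor_set = (\<Inter>n. cantor_step n)"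

text \<open>The pairs \<open>(p, q)\<close> are not required to be coprime; hence rationals satisfy every instance.\<close>
definition approximable :: "real \<Rightarrow> real \<Rightarrow> bool" where
  "approximable \<epsilon> x \<longleftrightarrow>
     infinite {(p :: int, q :: nat). 0 < q \<and>
                 \<bar>x - real_of_int p / real q\<bar> < real q powr (- (2 + \<epsilon>))}"

definition very_well_approximable :: "real set" where
  "very_well_approximable = {x. \<exists>\<epsilon>>0. approximable \<epsilon> x}"

definition liouville_numbers :: "real set" where
  "liouville_numbers = {x. \<forall>\<epsilon>>0. approximable \<epsilon> x}"

end

theory Submission imports Defs "HOL-Real_Asymp.Real_Asymp" begin

text \<open>
  Fix \<open>N \<ge> 5\<close> and put \<open>n\<^sub>k = N^(k+1)\<close>, \<open>m\<^sub>k = 2 N^(k+1) + N^k\<close>. To \<open>t \<in> [0,1)\<close> we attach the number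
  \<open>x(t)\<close> whose ternary digits are \<open>0\<close> on \<open>[n\<^sub>k, m\<^sub>k)\<close> and \<open>2\<close> at \<open>m\<^sub>k\<close>, and are otherwise twice the
  successive binary digits of \<open>t\<close>. Truncating \<open>x(t)\<close> at \<open>n\<^sub>k\<close> gives \<open>p\<^sub>k / q\<^sub>k\<close> with
  \<open>q\<^sub>k = 3^n\<^sub>k\<close> and \<open>2/3 \<cdot> 3^-m\<^sub>k \<le> x(t) - p\<^sub>k / q\<^sub>k \<le> 3^-m\<^sub>k\<close>, so \<open>x(t)\<close> is very well approximable. As
  \<open>q\<^sub>k\<^sub>+\<^sub>1 = q\<^sub>k^N\<close>, comparing an arbitrary fraction \<open>p/q\<close> with the first \<open>p\<^sub>k / q\<^sub>k\<close> for which
  \<open>q\<^sub>k \<ge> 2 q\<close> bounds \<open>|x(t) - p/q|\<close> below by a fixed power of \<open>q\<close>, so \<open>x(t)\<close> is not Liouville.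
  At least the fraction \<open>(N-4)/(2N+2)\<close> of the first \<open>l\<close> digits is unconstrained, so the inverse of
  \<open>x\<close> is Hoelder and pulling covers back to \<open>[0,1)\<close> bounds the dimension below by
  \<open>ln 2 / ln 3 \<cdot> (N-4)/(2N+2)\<close>. Let \<open>N\<close> tend to infinity.
\<close>

section \<open>Lower bounds for the Hausdorff dimension\<close>

text \<open>A cover of \<open>A\<close> pulls back along \<open>X\<close> to a cover of [0,1) whose
  members have extent at most \<open>C\<close> times the s-th power of the diameter. Total length at
  least 1 then forces the sum over the cover to be at least \<open>1 / C\<close>.\<close>

lemma hausdorff_measure_nonzero_if_inverse_Hoelder:
  fixes X :: "real \<Rightarrow> 'a::metric_space"
  assumes X: "X ` {0..<1} \<subseteq> A" and C: "C > 0" and s: "s \<ge> 0"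
    and hoelder: "\<And>t u. t \<in> {0..<1} \<Longrightarrow> u \<in> {0..<1} \<Longrightarrow> \<bar>t - u\<bar> \<le> C * dist (X t) (X u) powr s"
  shows "hausdorff_measure s A \<noteq> 0"
proof -
  have cover: "ennreal (1 / C) \<le> (\<Sum>i. diam_pow s (U i))"
    if U: "A \<subseteq> (\<Union>i. U i)" "\<And>i. bounded (U i)" for U :: "nat \<Rightarrow> 'a set"
  proof -
    define V where "V i = {t \<in> {0..<1}. X t \<in> U i}" for i
    \<comment> \<open>\<open>X\<close> is arbitrary, so \<open>V i\<close> may fail to be
      measurable; its closed interval hull is measurable and no longer than the extent of
      \<open>V i\<close>.\<close>
    define W where "W i = (if V i = {} then {} else {Inf (V i)..Sup (V i)})" for i
    have bdd: "bdd_above (V i)" "bdd_below (V i)" for i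
      by (auto simp: V_def intro!: bdd_aboveI[of _ 1] bdd_belowI[of _ 0])
    have VW: "V i \<subseteq> W i" for i
      using cInf_lower[OF _ bdd(2)] cSup_upper[OF _ bdd(1)] by (auto simp: W_def)
    have sub: "{0..<1} \<subseteq> (\<Union>i. W i)"
    proof
      fix t :: real assume t: "t \<in> {0..<1}"
      then obtain i where "X t \<in> U i" using X U(1) by blast
      with t VW[of i] show "t \<in> (\<Union>i. W i)" by (auto simp: V_def)
    qed
    have meas: "emeasure lborel (W i) \<le> ennreal C * diam_pow s (U i)" for i
    proof (cases "V i = {}")
      case True then show ?thesis by (simp add: W_def)
    next
      case False
      \<comment> \<open>The case \<open>s = 0\<close> mirrors \<open>diam_pow\<close>: a set of
        diameter 0 must still count as 1, whereas \<open>0 powr 0 = 0\<close>.\<close>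
      define D where "D = (if s = 0 then 1 else diameter (U i) powr s)"
      have le: "t \<le> u + C * D" if "t \<in> V i" "u \<in> V i" for t u
      proof -
        have d: "dist (X t) (X u) \<le> diameter (U i)"
          using that U(2) by (intro diameter_bounded_bound) (auto simp: V_def)
        have "dist (X t) (X u) powr s \<le> D"
          using d s by (cases "s = 0") (auto simp: D_def intro!: powr_mono2)
        then have "C * dist (X t) (X u) powr s \<le> C * D" using C by simp
        moreover have "\<bar>t - u\<bar> \<le> C * dist (X t) (X u) powr s"
          using that by (intro hoelder) (auto simp: V_def)
        ultimately show ?thesis by linarith
      qed
      have "Sup (V i) \<le> u + C * D" if "u \<in> V i" for u
        using False le that by (intro cSup_least) auto
      then have "Sup (V i) - C * D \<le> Inf (V i)"
        using False by (intro cInf_greatest) (auto simp: algebra_simps)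
      moreover have "Inf (V i) \<le> Sup (V i)"
        using False bdd by (intro cInf_le_cSup)
      moreover have "U i \<noteq> {}" using False by (auto simp: V_def)
      ultimately show ?thesis
        using False C
        by (auto simp: W_def diam_pow_def D_def ennreal_mult[symmetric] intro!: ennreal_leI)
    qed
    have "1 = emeasure lborel {0..<1::real}" by simp
    also have "\<dots> \<le> emeasure lborel (\<Union>i. W i)"
      using sub by (intro emeasure_mono) (auto simp: W_def)
    also have "\<dots> \<le> (\<Sum>i. emeasure lborel (W i))"
      by (intro emeasure_subadditive_countably) (auto simp: W_def)
    also have "\<dots> \<le> (\<Sum>i. ennreal C * diam_pow s (U i))"
      by (intro suminf_le meas) auto
    also have "\<dots> = ennreal C * (\<Sum>i. diam_pow s (U i))"
      by simp
    finally have "ennreal (1 / C) * 1 \<le> ennreal (1 / C) * (ennreal C * (\<Sum>i. diam_pow s (U i)))"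
      by (intro mult_left_mono) auto
    then show ?thesis
      using C by (simp add: mult.assoc[symmetric] ennreal_mult[symmetric])
  qed
  have "ennreal (1 / C) \<le> hausdorff_pre s 1 A"
    unfolding hausdorff_pre_def by (intro INF_greatest cover) auto
  also have "\<dots> \<le> hausdorff_measure s A"
    unfolding hausdorff_measure_def by (rule SUP_upper) simp
  finally show ?thesis using C by (auto simp: ennreal_eq_0_iff)
qed

text \<open>The infimum defining the dimension requires nonzero measure for every
  \<open>s < a\<close>. Raising the estimate to the power \<open>s / a < 1\<close> yields one with
  exponent \<open>s\<close>, because distances in [0,1) are below 1 and only grow under such a
  power.\<close>

lemma hausdorff_dim_ge_if_inverse_Hoelder:
  fixes X :: "real \<Rightarrow> 'a::metric_space"
  assumes X: "X ` {0..<1} \<subseteq> A" and C: "C > 0" and a: "a > 0"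
    and hoelder: "\<And>t u. t \<in> {0..<1} \<Longrightarrow> u \<in> {0..<1} \<Longrightarrow> \<bar>t - u\<bar> \<le> C * dist (X t) (X u) powr a"
  shows "ereal a \<le> hausdorff_dim A"
  unfolding hausdorff_dim_def
proof (intro Inf_greatest, clarify)
  fix s :: real assume s: "0 \<le> s" "hausdorff_measure s A = 0"
  have False if "s < a"
  proof -
    have "\<bar>t - u\<bar> \<le> C powr (s / a) * dist (X t) (X u) powr s"
      if tu: "t \<in> {0..<1}" "u \<in> {0..<1}" for t u
    proof (cases "t = u")
      case False
      have "\<bar>t - u\<bar> = \<bar>t - u\<bar> powr 1" by simp
      also have "\<dots> \<le> \<bar>t - u\<bar> powr (s / a)"
        using tu \<open>s < a\<close> a by (intro powr_mono') auto
      also have "\<dots> \<le> (C * dist (X t) (X u) powr a) powr (s / a)"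
        using s a by (intro powr_mono2 hoelder tu) auto
      also have "\<dots> = C powr (s / a) * dist (X t) (X u) powr s"
        using C a by (simp add: powr_mult powr_powr)
      finally show ?thesis .
    qed simp
    with hausdorff_measure_nonzero_if_inverse_Hoelder[OF X, of "C powr (s / a)" s] s C
    show False by simp
  qed
  then show "ereal a \<le> ereal s" by force
qed

section \<open>Ternary expansions\<close>

definition ternary :: "(nat \<Rightarrow> nat) \<Rightarrow> real" where
  "ternary d = (\<Sum>i. real (d i) / 3 ^ Suc i)"

locale ternary_02 =
  fixes d :: "nat \<Rightarrow> nat"
  assumes digit: "d i \<in> {0, 2}"
begin

lemma digit_le: "d i \<le> 2"
  using digit[of i] by auto

lemma shift: "ternary_02 (\<lambda>i. d (n + i))"
  using digit by unfold_locales

lemma sums_two_thirds: "(\<lambda>i. 2 / 3 ^ Suc i) sums (1::real)"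
  using sums_mult[OF geometric_sums[of "1/3::real"], of "2/3"] by (simp add: power_one_over field_simps)

lemma summable: "summable (\<lambda>i. real (d i) / 3 ^ Suc i)"
  using digit_le
  by (intro summable_comparison_test[OF _ sums_summable[OF sums_two_thirds]] exI[of _ 0])
     (auto intro!: divide_right_mono)

lemma ternary_bounds: "0 \<le> ternary d" "ternary d \<le> 1"
proof -
  show "0 \<le> ternary d"
    unfolding ternary_def by (intro suminf_nonneg summable) auto
  have "ternary d \<le> (\<Sum>i. 2 / 3 ^ Suc i)"
    unfolding ternary_def using digit_le
    by (intro suminf_le summable sums_summable[OF sums_two_thirds]) (auto intro!: divide_right_mono)
  then show "ternary d \<le> 1"
    using sums_unique[OF sums_two_thirds] by simp
qed

lemma ternary_split:
  "ternary d = (\<Sum>i<n. real (d i) / 3 ^ Suc i) + ternary (\<lambda>i. d (n + i)) / 3 ^ n"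
proof -
  have "ternary d = (\<Sum>i. real (d (i + n)) / 3 ^ Suc (i + n)) + (\<Sum>i<n. real (d i) / 3 ^ Suc i)"
    unfolding ternary_def by (rule suminf_split_initial_segment[OF summable])
  also have "(\<Sum>i. real (d (i + n)) / 3 ^ Suc (i + n)) = (\<Sum>i. real (d (n + i)) / 3 ^ Suc i / 3 ^ n)"
    by (simp add: power_add add.commute mult.assoc)
  also have "\<dots> = ternary (\<lambda>i. d (n + i)) / 3 ^ n"
    unfolding ternary_def using ternary_02.summable[OF shift] by (rule suminf_divide)
  finally show ?thesis by simp
qed

lemma ternary_Suc: "ternary d = (real (d 0) + ternary (\<lambda>i. d (Suc i))) / 3"
  using ternary_split[of 1] by (simp add: add_divide_distrib)

end

lemma ternary_in_cantor_step: "ternary_02 d \<Longrightarrow> ternary d \<in> cantor_step n"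
proof (induction n arbitrary: d)
  case 0
  then show ?case using ternary_02.ternary_bounds by auto
next
  case (Suc n)
  interpret ternary_02 d by fact
  have "ternary (\<lambda>i. d (Suc i)) \<in> cantor_step n"
    using Suc.IH shift[of 1] by simp
  moreover have "d 0 = 0 \<or> d 0 = 2" using digit[of 0] by simp
  ultimately show ?case
    unfolding ternary_Suc by (auto simp: add.commute)
qed

lemma ternary_in_cantor_set: "ternary_02 d \<Longrightarrow> ternary d \<in> cantor_set"
  by (simp add: cantor_set_def ternary_in_cantor_step)

text \<open>At the first disagreement the digits differ by 2, while the two tails differ by at most
  1 in the same unit, so at least one unit remains.\<close>

lemma ternary_diff_ge:
  assumes "ternary_02 d" "ternary_02 e" and eq: "\<And>i. i < n \<Longrightarrow> d i = e i" and "d n \<noteq> e n"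
  shows "1 / 3 ^ Suc n \<le> \<bar>ternary d - ternary e\<bar>"
proof -
  interpret d: ternary_02 d by fact
  interpret e: ternary_02 e by fact
  define x where "x = ternary (\<lambda>i. d (Suc n + i))"
  define y where "y = ternary (\<lambda>i. e (Suc n + i))"
  have xy: "0 \<le> x" "x \<le> 1" "0 \<le> y" "y \<le> 1"
    unfolding x_def y_def by (intro ternary_02.ternary_bounds d.shift e.shift)+
  have "(\<Sum>i<n. real (d i) / 3 ^ Suc i) = (\<Sum>i<n. real (e i) / 3 ^ Suc i)"
    using eq by simp
  then have "ternary d - ternary e = (real (d n) - real (e n) + x - y) / 3 ^ Suc n"
    using d.ternary_split[of "Suc n"] e.ternary_split[of "Suc n"]
    by (simp add: x_def y_def diff_divide_distrib add_divide_distrib)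
  moreover have "1 \<le> \<bar>real (d n) - real (e n) + x - y\<bar>"
    using xy d.digit[of n] e.digit[of n] \<open>d n \<noteq> e n\<close> by auto
  ultimately show ?thesis by (simp add: abs_divide divide_right_mono)
qed

lemma ternary_partial_sum_int: "\<exists>p::int. (\<Sum>i<n. real (d i) / 3 ^ Suc i) = real_of_int p / 3 ^ n"
proof (induction n)
  case 0
  then show ?case by (intro exI[of _ 0]) simp
next
  case (Suc n)
  then obtain p :: int where "(\<Sum>i<n. real (d i) / 3 ^ Suc i) = real_of_int p / 3 ^ n" ..
  then show ?case by (intro exI[of _ "3 * p + int (d n)"]) (simp add: add_divide_distrib)
qed

section \<open>Binary digits\<close>

definition binary_digit :: "real \<Rightarrow> nat \<Rightarrow> nat" where
  "binary_digit t i = nat (\<lfloor>2 ^ Suc i * t\<rfloor> mod 2)"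

text \<open>The quotient and remainder of \<open>\<lfloor>2 ^ Suc n * t\<rfloor>\<close> modulo 2
  are \<open>\<lfloor>2 ^ n * t\<rfloor>\<close> and the digit of index \<open>n\<close>, so
  equality propagates by induction.\<close>

lemma floor_power_eq_if_binary_digits_eq:
  assumes tu: "t \<in> {0..<1}" "u \<in> {0..<1}" and "\<And>i. i < n \<Longrightarrow> binary_digit t i = binary_digit u i"
  shows "\<lfloor>2 ^ n * t\<rfloor> = \<lfloor>2 ^ n * u\<rfloor>"
  using assms(3)
proof (induction n)
  case 0
  have "\<lfloor>t\<rfloor> = 0" "\<lfloor>u\<rfloor> = 0" using tu by (simp_all add: floor_eq_iff)
  then show ?case by simp
next
  case (Suc n)
  have div2: "\<lfloor>2 ^ Suc n * v\<rfloor> div 2 = \<lfloor>2 ^ n * v\<rfloor>" for v :: real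
    using floor_divide_real_eq_div[of 2 "2 ^ Suc n * v"] by simp
  have "\<lfloor>2 ^ Suc n * t\<rfloor> mod 2 = \<lfloor>2 ^ Suc n * u\<rfloor> mod 2"
    using Suc.prems[of n] by (simp add: binary_digit_def eq_nat_nat_iff)
  moreover have "\<lfloor>2 ^ Suc n * t\<rfloor> div 2 = \<lfloor>2 ^ Suc n * u\<rfloor> div 2"
    unfolding div2 using Suc by simp
  ultimately show ?case by (metis mult_div_mod_eq)
qed

lemma binary_digits_diff_le:
  assumes "t \<in> {0..<1}" "u \<in> {0..<1}" "\<And>i. i < n \<Longrightarrow> binary_digit t i = binary_digit u i"
  shows "\<bar>t - u\<bar> \<le> 1 / 2 ^ n"
proof -
  have "\<lfloor>2 ^ n * t\<rfloor> = \<lfloor>2 ^ n * u\<rfloor>" by (rule floor_power_eq_if_binary_digits_eq) fact+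
  then have "\<bar>2 ^ n * t - 2 ^ n * u\<bar> \<le> 1" by linarith
  then have "2 ^ n * \<bar>t - u\<bar> \<le> 1"
    by (simp add: right_diff_distrib[symmetric] abs_mult)
  then show ?thesis by (simp add: field_simps)
qed

lemma first_binary_digit_diff:
  assumes tu: "t \<in> {0..<1}" "u \<in> {0..<1}" "t \<noteq> u"
  obtains j where "binary_digit t j \<noteq> binary_digit u j" "\<And>i. i < j \<Longrightarrow> binary_digit t i = binary_digit u i"
proof -
  obtain n where "(1/2) ^ n < \<bar>t - u\<bar>"
    using real_arch_pow_inv[of "\<bar>t - u\<bar>" "1/2"] tu by auto
  then have "\<exists>i. binary_digit t i \<noteq> binary_digit u i"
    using binary_digits_diff_le[of t u n] tu by (force simp: power_one_over)
  then show thesis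
    using that exists_least_iff[of "\<lambda>i. binary_digit t i \<noteq> binary_digit u i"] by blast
qed

section \<open>Numbers with prescribed blocks of digits\<close>

locale blocks =
  fixes N :: nat
  assumes N: "N \<ge> 5"
begin

text \<open>The ratio of end to start is 2 + 1/N: the excess over 2 makes the points very well
  approximable, and its smallness lets about half of the positions stay free.\<close>

definition block_start :: "nat \<Rightarrow> nat" where "block_start k = N ^ Suc k"
definition block_end :: "nat \<Rightarrow> nat" where "block_end k = 2 * N ^ Suc k + N ^ k"
definition prescribed :: "nat set" where
  "prescribed = (\<Union>k. {block_start k..block_end k})"

primrec free_count :: "nat \<Rightarrow> nat" where
  "free_count 0 = 0"
| "free_count (Suc l) = free_count l + (if l \<in> prescribed then 0 else 1)"

definition digits :: "real \<Rightarrow> nat \<Rightarrow> nat" where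
  "digits t i = (if i \<in> range block_end then 2 else if i \<in> prescribed then 0
                 else 2 * binary_digit t (free_count i))"

definition point :: "real \<Rightarrow> real" where
  "point t = ternary (digits t)"

lemma Npow_pos: "N ^ k \<ge> 1"
  using N by simp

lemma Npow_Suc_ge: "5 * N ^ k \<le> N ^ Suc k"
  using N by simp

lemma block_start_le_end: "block_start k \<le> block_end k"
  by (simp add: block_start_def block_end_def)

lemma block_end_less_start: "block_end k < block_start (Suc k)"
proof -
  have "5 * N ^ Suc k \<le> N ^ Suc (Suc k)" "5 * N ^ k \<le> N ^ Suc k" "N ^ k \<ge> 1"
    by (rule Npow_Suc_ge Npow_pos)+
  then show ?thesis unfolding block_start_def block_end_def by linarith
qed

lemma block_start_mono: "j \<le> k \<Longrightarrow> block_start j \<le> block_start k"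
  using N by (auto simp: block_start_def intro: power_increasing)

lemma block_end_mono: "j \<le> k \<Longrightarrow> block_end j \<le> block_end k"
  using N by (auto simp: block_end_def intro!: add_mono mult_left_mono power_increasing)

lemma not_prescribed_gap:
  assumes "block_end k < l" "l < block_start (Suc k)"
  shows "l \<notin> prescribed"
proof
  assume "l \<in> prescribed"
  then obtain j where j: "block_start j \<le> l" "l \<le> block_end j" by (auto simp: prescribed_def)
  show False
    using j assms block_end_mono[of j k] block_start_mono[of "Suc k" j] by (cases "j \<le> k") auto
qed

lemma not_prescribed_initial: "l < block_start 0 \<Longrightarrow> l \<notin> prescribed"
  using block_start_mono[OF le0] by (auto simp: prescribed_def not_le intro: order.strict_trans2)

lemma block_interior_not_end:
  assumes "block_start k \<le> i" "i < block_end k"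
  shows "i \<notin> range block_end"
proof
  assume "i \<in> range block_end"
  then obtain j where j: "i = block_end j" by auto
  show False
    using assms j block_end_mono[of k j] block_end_less_start[of j] block_start_mono[of "Suc j" k]
    by (cases "k \<le> j") auto
qed

section \<open>Density of the free positions\<close>

lemma free_count_mono: "l \<le> l' \<Longrightarrow> free_count l \<le> free_count l'"
  by (rule lift_Suc_mono_le) auto

lemma free_count_gap:
  assumes "block_end k < l" "l \<le> block_start (Suc k)"
  shows "free_count l = free_count (Suc (block_end k)) + (l - Suc (block_end k))"
  using assms
proof (induction l)
  case (Suc l)
  show ?case
  proof (cases "l = block_end k")
    case False
    then have "l \<notin> prescribed" using Suc.prems not_prescribed_gap[of k l] by simp
    with False Suc show ?thesis by simp
  qed simp
qed simp

lemma free_count_initial: "l \<le> block_start 0 \<Longrightarrow> free_count l = l"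
  by (induction l) (auto simp: not_prescribed_initial)

text \<open>Up to 2 N^k prescribed positions precede block k, and the block, both ends included,
  adds N^(k+1) + N^k + 1 more.\<close>

lemma free_count_gap_ge:
  assumes "block_start k \<le> free_count (block_start k) + 2 * N ^ k"
    and "block_end k < l" "l \<le> block_start (Suc k)"
  shows "l \<le> free_count l + N ^ Suc k + 4 * N ^ k"
proof -
  have "free_count (block_start k) \<le> free_count (Suc (block_end k))"
    using block_start_le_end[of k] by (intro free_count_mono) simp
  then show ?thesis
    using assms free_count_gap[OF assms(2,3)] Npow_pos[of k]
    unfolding block_start_def block_end_def by linarith
qed

text \<open>The bound reproduces itself: \<open>free_count_gap_ge\<close> allows N^(k+1) + 4 N^k
  prescribed positions before the next block, which is at most 2 N^(k+1) since N is at least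
  5.\<close>

lemma free_count_block_start: "block_start k \<le> free_count (block_start k) + 2 * N ^ k"
proof (induction k)
  case 0
  then show ?case using free_count_initial by simp
next
  case (Suc k)
  show ?case
    using free_count_gap_ge[OF Suc block_end_less_start order.refl] Npow_Suc_ge[of k] by linarith
qed

lemma free_count_ge: "(real N - 4) * real l \<le> (2 * real N + 2) * real (free_count l)"
proof (cases "l \<le> block_start 0")
  case True
  then show ?thesis using N by (auto simp: free_count_initial intro!: mult_right_mono)
next
  case False
  have "\<exists>k. l < block_start k"
  proof
    have "l < 5 ^ l" by (rule less_exp[THEN order.strict_trans2]) (simp add: power_mono)
    also have "\<dots> \<le> N ^ l" using N by (intro power_mono) auto
    also have "\<dots> \<le> block_start l" using N by (simp add: block_start_def)
    finally show "l < block_start l" .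
  qed
  then obtain k' where k': "l < block_start k'" "\<And>j. j < k' \<Longrightarrow> block_start j \<le> l"
    using exists_least_iff[of "\<lambda>k. l < block_start k"] by (auto simp: not_less)
  with False obtain k where "k' = Suc k" by (cases k') auto
  with k' have k: "block_start k \<le> l" "l < block_start (Suc k)" by auto
  define P where "P = real (N ^ k)"
  have P: "P \<ge> 1" using Npow_pos[of k] unfolding P_def by linarith
  have P': "real (N ^ Suc k) = real N * P" by (simp add: P_def)
  show ?thesis
  proof (cases "l \<le> block_end k")
    case True
    \<comment> \<open>Inside a block it suffices to count the free positions before it, against the
      largest possible \<open>l\<close>.\<close>
    have "block_start k \<le> free_count l + 2 * N ^ k"
      using free_count_block_start[of k] free_count_mono[OF k(1)] by simp
    then have "real (N ^ Suc k) \<le> real (free_count l) + 2 * real (N ^ k)"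
      unfolding block_start_def by linarith
    then have f: "(real N - 2) * P \<le> real (free_count l)"
      unfolding P' P_def[symmetric] by (simp add: algebra_simps)
    have "real l \<le> 2 * real (N ^ Suc k) + real (N ^ k)"
      using True unfolding block_end_def by linarith
    then have l: "real l \<le> (2 * real N + 1) * P"
      unfolding P' P_def[symmetric] by (simp add: algebra_simps)
    have "(real N - 4) * real l \<le> (real N - 2) * ((2 * real N + 2) * P)"
      using N l P by (intro mult_mono order.trans[OF l] mult_right_mono) auto
    also have "\<dots> = (2 * real N + 2) * ((real N - 2) * P)" by simp
    also have "\<dots> \<le> (2 * real N + 2) * real (free_count l)"
      by (intro mult_left_mono f) auto
    finally show ?thesis .
  next
    case False
    then have "l \<le> free_count l + N ^ Suc k + 4 * N ^ k"
      using k free_count_block_start by (intro free_count_gap_ge) auto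
    then have "real l \<le> real (free_count l) + real (N ^ Suc k) + 4 * real (N ^ k)"
      by linarith
    then have f: "real l - (real N + 4) * P \<le> real (free_count l)"
      unfolding P' P_def[symmetric] by (simp add: algebra_simps)
    have "2 * real (N ^ Suc k) + real (N ^ k) \<le> real l"
      using False unfolding block_end_def by linarith
    then have l: "2 * real N * P \<le> real l"
      using P unfolding P' P_def[symmetric] by (simp add: algebra_simps)
    \<comment> \<open>As (2N+2) - (N-4) = N+6, the goal reduces to bounding (2N+2)(N+4)P by (N+6)l;
      after the block, l is at least 2NP.\<close>
    have "(2 * real N + 2) * ((real N + 4) * P) \<le> (real N + 6) * (2 * real N * P)"
      using P N mult_right_mono[of 4 "2 * real N" P] by (simp add: algebra_simps)
    also have "\<dots> \<le> (real N + 6) * real l"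
      using l by (intro mult_left_mono) auto
    finally have "(real N - 4) * real l \<le> (2 * real N + 2) * (real l - (real N + 4) * P)"
      by (simp add: algebra_simps)
    also have "\<dots> \<le> (2 * real N + 2) * real (free_count l)"
      by (intro mult_left_mono f) auto
    finally show ?thesis .
  qed
qed

text \<open>Every binary digit of \<open>t\<close> is thus recorded somewhere in
  \<open>point t\<close>. Positive density makes \<open>free_count\<close> unbounded, and it
  increases by at most 1 at a time, so it skips no value.\<close>

lemma free_position_exists:
  obtains l where "l \<notin> prescribed" "free_count l = j"
proof -
  define m where "m = (2 * N + 2) * Suc j"
  have "real N - 4 \<ge> 1" using N by simp
  then have "1 * real m \<le> (real N - 4) * real m" by (intro mult_right_mono) auto
  also have "\<dots> \<le> (2 * real N + 2) * real (free_count m)" by (rule free_count_ge)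
  finally have "(2 * real N + 2) * real (Suc j) \<le> (2 * real N + 2) * real (free_count m)"
    by (simp add: m_def algebra_simps)
  then have "j < free_count m" by simp
  then obtain l' where l': "j < free_count l'" "\<And>i. i < l' \<Longrightarrow> free_count i \<le> j"
    using exists_least_iff[of "\<lambda>l. j < free_count l"] by (auto simp: not_less)
  then obtain l where l: "l' = Suc l" by (cases l') auto
  then have "free_count l \<le> j" using l'(2)[of l] by simp
  with l l'(1) show thesis using that[of l] by (auto split: if_splits)
qed

section \<open>Rational approximations of the constructed points\<close>

lemma digits_02: "ternary_02 (digits t)"
  by unfold_locales (auto simp: digits_def binary_digit_def)

lemma digits_block: "block_start k \<le> i \<Longrightarrow> i < block_end k \<Longrightarrow> digits t i = 0"
  using block_interior_not_end[of k i] by (fastforce simp: digits_def prescribed_def)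

lemma digits_block_end: "digits t (block_end k) = 2"
  by (simp add: digits_def)

text \<open>The zeros of the block let the truncation at \<open>block_start k\<close> agree with the
  one at \<open>block_end k\<close>. The rest is a scaled expansion with leading digit 2, hence in
  [2/3, 1].\<close>

lemma point_truncation:
  obtains p :: int where
    "2 / 3 / 3 ^ block_end k \<le> point t - real_of_int p / 3 ^ block_start k"
    "point t - real_of_int p / 3 ^ block_start k \<le> 1 / 3 ^ block_end k"
proof -
  interpret ternary_02 "digits t" by (rule digits_02)
  define s where "s i = real (digits t i) / 3 ^ Suc i" for i
  define y where "y = ternary (\<lambda>i. digits t (block_end k + i))"
  obtain p :: int where p: "(\<Sum>i<block_start k. s i) = real_of_int p / 3 ^ block_start k"
    using ternary_partial_sum_int unfolding s_def by blast
  have "(\<Sum>i<block_end k. s i) = (\<Sum>i<block_start k. s i)"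
    using block_start_le_end[of k]
    by (intro sum.mono_neutral_right) (auto simp: s_def digits_block)
  then have eq: "point t - real_of_int p / 3 ^ block_start k = y / 3 ^ block_end k"
    using ternary_split[of "block_end k"] p by (simp add: point_def y_def s_def)
  interpret y: ternary_02 "\<lambda>i. digits t (block_end k + i)" by (rule shift)
  have "2 / 3 \<le> y" "y \<le> 1"
    using y.ternary_bounds y.ternary_Suc ternary_02.ternary_bounds(1)[OF y.shift, of 1]
    by (simp_all add: y_def digits_block_end)
  with eq show thesis by (intro that[of p]) (simp_all add: field_simps)
qed

lemma point_in_cantor_set: "point t \<in> cantor_set"
  unfolding point_def by (intro ternary_in_cantor_set digits_02)

lemma point_very_well_approximable: "point t \<in> very_well_approximable"
proof -
  \<comment> \<open>The truncations have error at most q^-(2 + 1/N); half of the excess 1/N makes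
    the inequality strict.\<close>
  define \<epsilon> where "\<epsilon> = 1 / (2 * real N)"
  have \<epsilon>: "\<epsilon> > 0" using N by (simp add: \<epsilon>_def)
  let ?S = "{(p :: int, q :: nat). 0 < q \<and>
    \<bar>point t - real_of_int p / real q\<bar> < real q powr (- (2 + \<epsilon>))}"
  have "3 ^ block_start k \<in> snd ` ?S" for k
  proof -
    obtain p :: int where p:
      "2 / 3 / 3 ^ block_end k \<le> point t - real_of_int p / 3 ^ block_start k"
      "point t - real_of_int p / 3 ^ block_start k \<le> 1 / 3 ^ block_end k"
      using point_truncation by blast
    have "0 \<le> 2 / 3 / (3::real) ^ block_end k" by simp
    with p have "\<bar>point t - real_of_int p / 3 ^ block_start k\<bar> \<le> 1 / 3 ^ block_end k"
      by linarith
    also have "\<dots> = 3 powr (- real (block_end k))"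
      by (simp add: powr_minus powr_realpow divide_inverse)
    also have "\<dots> < 3 powr (real (block_start k) * (- (2 + \<epsilon>)))"
      using N by (simp add: block_start_def block_end_def \<epsilon>_def field_simps)
    also have "\<dots> = real (3 ^ block_start k) powr (- (2 + \<epsilon>))"
      by (simp add: powr_powr powr_realpow[symmetric])
    finally have "(p, 3 ^ block_start k) \<in> ?S" by simp
    then show ?thesis by force
  qed
  then have "range (\<lambda>k. 3 ^ block_start k) \<subseteq> snd ` ?S" by blast
  moreover have "infinite (range (\<lambda>k. 3 ^ block_start k :: nat))"
    using N by (intro range_inj_infinite injI) (simp add: block_start_def)
  ultimately have "infinite ?S" by (meson finite_imageI finite_subset)
  then show ?thesis
    using \<epsilon> by (auto simp: very_well_approximable_def approximable_def)
qed

text \<open>If p/q is the truncation r/Q, the lower error bound applies. Otherwise the fractions are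
  at least 1/(qQ), hence 2/Q^2, apart, while the point is within 1/Q^2 of r/Q.\<close>

lemma point_diff_ge_truncation:
  fixes p :: int and q k :: nat
  assumes q: "0 < q" "2 * q \<le> 3 ^ block_start k"
  shows "1 / (3 ^ block_start k) ^ 4 \<le> \<bar>point t - real_of_int p / real q\<bar>"
proof -
  define Q :: nat where "Q = 3 ^ block_start k"
  have Q: "real Q \<ge> 3" unfolding Q_def using self_le_power[of "3::real" "block_start k"] N
    by (simp add: block_start_def)
  obtain r :: int where r:
    "2 / 3 / 3 ^ block_end k \<le> point t - real_of_int r / 3 ^ block_start k"
    "point t - real_of_int r / 3 ^ block_start k \<le> 1 / 3 ^ block_end k"
    using point_truncation by blast
  have "block_end k \<le> 3 * block_start k"
    using Npow_Suc_ge[of k] unfolding block_start_def block_end_def by linarith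
  then have "(3::real) ^ block_end k \<le> real Q ^ 3"
    by (simp add: Q_def power_mult[symmetric] mult.commute)
  \<comment> \<open>The fourth factor \<open>Q\<close> absorbs the constant 3/2; this is why the
    exponent is 4 and not 3.\<close>
  then have "3 / 2 * (3::real) ^ block_end k \<le> real Q * real Q ^ 3"
    using Q by (intro mult_mono) auto
  then have lo: "1 / real Q ^ 4 \<le> 2 / 3 / 3 ^ block_end k"
    using Q by (simp add: field_simps power_numeral_reduce)
  have "2 * block_start k \<le> block_end k"
    by (simp add: block_start_def block_end_def)
  then have "real Q ^ 2 \<le> (3::real) ^ block_end k"
    by (simp add: Q_def power_mult[symmetric] mult.commute)
  then have hi: "1 / 3 ^ block_end k \<le> 1 / real Q ^ 2"
    using Q by (intro divide_left_mono) auto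
  show ?thesis
  proof (cases "real_of_int p / real q = real_of_int r / real Q")
    case True
    then show ?thesis using r lo by (simp add: Q_def)
  next
    case False
    have "p * int Q - r * int q \<noteq> 0"
    proof
      assume "p * int Q - r * int q = 0"
      then have "p * int Q = r * int q" by simp
      then have "real_of_int p * real Q = real_of_int r * real q"
        by (metis of_int_mult of_int_of_nat_eq)
      with False q Q show False by (simp add: frac_eq_eq)
    qed
    then have "1 \<le> \<bar>p * int Q - r * int q\<bar>" by linarith
    then have "real_of_int 1 \<le> real_of_int \<bar>p * int Q - r * int q\<bar>" by (simp only: of_int_le_iff)
    then have "1 \<le> \<bar>real_of_int p * real Q - real_of_int r * real q\<bar>" by simp
    then have "1 / (real q * real Q) \<le> \<bar>real_of_int p * real Q - real_of_int r * real q\<bar> / (real q * real Q)"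
      by (intro divide_right_mono) auto
    also have "\<dots> = \<bar>real_of_int p / real q - real_of_int r / real Q\<bar>"
      using q Q by (simp add: diff_frac_eq abs_divide abs_mult)
    finally have far: "1 / (real q * real Q) \<le> \<bar>real_of_int p / real q - real_of_int r / real Q\<bar>" .
    have "2 * real q \<le> real Q" using q unfolding Q_def by (metis of_nat_le_iff of_nat_mult of_nat_numeral)
    then have "2 / (real Q * real Q) \<le> 1 / (real q * real Q)"
      using q Q by (simp add: field_simps)
    then have "2 / real Q ^ 2 \<le> 1 / (real q * real Q)"
      by (simp add: power2_eq_square)
    moreover have "\<bar>point t - real_of_int r / real Q\<bar> \<le> 1 / real Q ^ 2"
    proof -
      have "0 \<le> 2 / 3 / (3::real) ^ block_end k" by simp
      with r hi show ?thesis by (simp add: Q_def)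
    qed
    ultimately have "1 / real Q ^ 2 \<le> \<bar>point t - real_of_int p / real q\<bar>"
      using far by linarith
    moreover have "1 / real Q ^ 4 \<le> 1 / real Q ^ 2"
      using Q by (intro divide_left_mono power_increasing) auto
    ultimately show ?thesis by (simp add: Q_def)
  qed
qed

text \<open>With \<open>k\<close> least such that 2q is at most Q_k =
  3^\<open>block_start k\<close>, the previous denominator is below 2q, so Q_k < (2q)^N, which is at
  most q^(2N); the fourth power in \<open>point_diff_ge_truncation\<close> gives 8N.\<close>

lemma point_diff_ge:
  fixes p :: int and q :: nat
  assumes q: "3 ^ N \<le> q"
  shows "real q powr (- (8 * real N)) \<le> \<bar>point t - real_of_int p / real q\<bar>"
proof -
  have q3: "q \<ge> 3" using q N self_le_power[of "3::nat" N] by simp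
  have "\<exists>k. 2 * q \<le> 3 ^ block_start k"
  proof
    have "2 * q \<le> 2 ^ (2 * q)" by (rule less_imp_le[OF less_exp])
    also have "\<dots> \<le> 3 ^ (2 * q)" by (rule power_mono) auto
    also have "\<dots> \<le> 3 ^ block_start (2 * q)"
    proof (rule power_increasing)
      have "2 * q < 2 ^ (2 * q)" by (rule less_exp)
      also have "\<dots> \<le> N ^ (2 * q)" using N by (intro power_mono) auto
      also have "\<dots> \<le> block_start (2 * q)" using N by (simp add: block_start_def)
      finally show "2 * q \<le> block_start (2 * q)" by simp
    qed simp
    finally show "2 * q \<le> 3 ^ block_start (2 * q)" .
  qed
  then obtain k where k: "2 * q \<le> 3 ^ block_start k" "\<And>j. j < k \<Longrightarrow> 3 ^ block_start j < 2 * q"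
    using exists_least_iff[of "\<lambda>k. 2 * q \<le> 3 ^ block_start k"] by (auto simp: not_le)
  \<comment> \<open>The first denominator is 3^N, already below 2q by hypothesis.\<close>
  have "k \<noteq> 0" using k(1) q q3 by (cases k) (auto simp: block_start_def)
  then obtain j where j: "k = Suc j" by (cases k) auto
  have "(3::nat) ^ block_start k = (3 ^ block_start j) ^ N"
    by (simp add: j block_start_def power_mult[symmetric] mult.commute)
  also have "\<dots> \<le> (2 * q) ^ N"
    using k(2)[of j] j by (intro power_mono) auto
  also have "\<dots> \<le> (q ^ 2) ^ N"
    using q3 by (intro power_mono) (auto simp: power2_eq_square)
  finally have "((3::nat) ^ block_start k) ^ 4 \<le> ((q ^ 2) ^ N) ^ 4"
    by (intro power_mono) auto
  also have "\<dots> = q ^ (8 * N)" by (simp add: power_mult[symmetric] mult.commute)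
  finally have "real ((3 ^ block_start k) ^ 4) \<le> real (q ^ (8 * N))" by (rule of_nat_mono)
  then have "1 / real q ^ (8 * N) \<le> 1 / (3 ^ block_start k) ^ 4"
    using q3 by (intro divide_left_mono) auto
  also have "\<dots> \<le> \<bar>point t - real_of_int p / real q\<bar>"
    using k(1) q3 by (intro point_diff_ge_truncation) auto
  also have "1 / real q ^ (8 * N) = real q powr (- real (8 * N))"
    using q3 by (simp only: powr_minus_divide powr_realpow)
  finally show ?thesis by simp
qed

lemma point_not_liouville: "point t \<notin> liouville_numbers"
proof
  \<comment> \<open>Chosen so that 2 + \<epsilon> = 8N: by \<open>point_diff_ge\<close>, solutions
    then have q < 3^N, and each such q admits only boundedly many p.\<close>
  define \<epsilon> where "\<epsilon> = 8 * real N - 2"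
  have \<epsilon>: "\<epsilon> > 0" using N by (simp add: \<epsilon>_def)
  let ?S = "{(p :: int, q :: nat). 0 < q \<and>
    \<bar>point t - real_of_int p / real q\<bar> < real q powr (- (2 + \<epsilon>))}"
  define M :: int where "M = 2 * 3 ^ N"
  have "?S \<subseteq> {-M..M} \<times> {..<3 ^ N}"
  proof (rule subrelI)
    fix p :: int and q :: nat
    assume "(p, q) \<in> ?S"
    then have q: "0 < q" and less: "\<bar>point t - real_of_int p / real q\<bar> < real q powr (- (2 + \<epsilon>))"
      by simp_all
    have "q < 3 ^ N" using less point_diff_ge[of q t p] by (force simp: \<epsilon>_def)
    have "real q powr (- (2 + \<epsilon>)) \<le> real q powr 0"
      using q \<epsilon> by (intro powr_mono) auto
    then have "\<bar>point t - real_of_int p / real q\<bar> \<le> 1" using less q by simp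
    moreover have "0 \<le> point t" "point t \<le> 1"
      using ternary_02.ternary_bounds[OF digits_02] by (simp_all add: point_def)
    ultimately have "\<bar>real_of_int p / real q\<bar> \<le> 2" by linarith
    then have "\<bar>real_of_int p\<bar> \<le> 2 * real q" using q by (simp add: abs_divide field_simps)
    then have "\<bar>p\<bar> \<le> 2 * int q" by linarith
    also have "\<dots> \<le> M" using \<open>q < 3 ^ N\<close> unfolding M_def
      by (metis less_imp_le mult_left_mono of_nat_le_iff of_nat_numeral of_nat_power zero_le_numeral)
    finally show "(p, q) \<in> {-M..M} \<times> {..<3 ^ N}" using \<open>q < 3 ^ N\<close> by auto
  qed
  then have "\<not> approximable \<epsilon> (point t)"
    unfolding approximable_def by (auto intro: finite_subset)
  moreover assume "point t \<in> liouville_numbers"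
  ultimately show False using \<epsilon> by (simp add: liouville_numbers_def)
qed

section \<open>Dimension of the set of constructed points\<close>

lemma point_in_set: "point t \<in> (very_well_approximable - liouville_numbers) \<inter> cantor_set"
  using point_in_cantor_set point_very_well_approximable point_not_liouville by simp

text \<open>The density of free positions from \<open>free_count_ge\<close> times the dimension of
  the Cantor set.\<close>

definition exponent :: real where
  "exponent = (real N - 4) / (2 * real N + 2) * (ln 2 / ln 3)"

lemma exponent_pos: "exponent > 0"
  using N by (simp add: exponent_def)

text \<open>If the first differing binary digit has index j and sits at position l, the parameters
  are within 2^-j and the points at least 3^-(l+1) apart; \<open>free_count_ge\<close> compares j
  with l. The constant pays for the 1 in l+1.\<close>

lemma point_inverse_Hoelder:
  assumes tu: "t \<in> {0..<1}" "u \<in> {0..<1}"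
  shows "\<bar>t - u\<bar> \<le> 3 powr exponent * dist (point t) (point u) powr exponent"
proof (cases "t = u")
  case False
  then obtain j where j: "binary_digit t j \<noteq> binary_digit u j"
    "\<And>i. i < j \<Longrightarrow> binary_digit t i = binary_digit u i"
    using first_binary_digit_diff tu by metis
  obtain l where l: "l \<notin> prescribed" "free_count l = j"
    using free_position_exists .
  have not_end: "i \<notin> range block_end" if "i \<notin> prescribed" for i
    using that block_start_le_end by (auto simp: prescribed_def)
  \<comment> \<open>A free position before \<open>l\<close> raises the count, so the binary digit it
    carries has index below \<open>j\<close>.\<close>
  have "digits t i = digits u i" if "i < l" for i
    using j(2)[of "free_count i"] free_count_mono[of "Suc i" l] l that by (auto simp: digits_def)
  moreover have "digits t l \<noteq> digits u l"
    using j l not_end by (simp add: digits_def)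
  ultimately have far: "1 / 3 ^ Suc l \<le> dist (point t) (point u)"
    unfolding point_def dist_real_def by (intro ternary_diff_ge digits_02)
  have "(real N - 4) / (2 * real N + 2) * real l \<le> real j"
    using free_count_ge[of l] l by (simp add: field_simps)
  then have "(real N - 4) / (2 * real N + 2) * real l * (ln 2 / ln 3) \<le> real j * (ln 2 / ln 3)"
    by (rule mult_right_mono) simp
  then have jl: "exponent * real l \<le> real j * (ln 2 / ln 3)"
    by (simp add: exponent_def mult_ac)
  have "\<bar>t - u\<bar> \<le> 1 / 2 ^ j"
    using binary_digits_diff_le tu j by blast
  also have "\<dots> = 2 powr (- real j)"
    by (simp add: powr_minus_divide powr_realpow)
  \<comment> \<open>Change of base: 2 = 3^(ln 2 / ln 3).\<close>
  also have "\<dots> = 3 powr (- (real j * (ln 2 / ln 3)))"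
    by (simp add: powr_def)
  also have "\<dots> \<le> 3 powr (- (exponent * real l))"
    using jl by simp
  also have "\<dots> = 3 powr exponent * (1 / 3 ^ Suc l) powr exponent"
  proof -
    have "1 / 3 ^ Suc l = (3::real) powr (- real (Suc l))"
      by (simp only: powr_minus_divide powr_realpow)
    then have "(1 / 3 ^ Suc l) powr exponent = 3 powr (- real (Suc l) * exponent)"
      by (simp only: powr_powr)
    then show ?thesis by (simp add: powr_add[symmetric] algebra_simps)
  qed
  also have "\<dots> \<le> 3 powr exponent * dist (point t) (point u) powr exponent"
    using far exponent_pos by (intro mult_left_mono powr_mono2) auto
  finally show ?thesis .
qed simp

lemma exponent_le_hausdorff_dim:
  "ereal exponent \<le> hausdorff_dim ((very_well_approximable - liouville_numbers) \<inter> cantor_set)"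
  using point_in_set exponent_pos point_inverse_Hoelder
  by (intro hausdorff_dim_ge_if_inverse_Hoelder[of point _ "3 powr exponent"]) auto

end

theorem mainTheorem2:
  shows "hausdorff_dim ((very_well_approximable - liouville_numbers) \<inter> cantor_set)
           \<ge> ereal ((ln 2 / ln 3) / 2)
         \<and> (very_well_approximable - liouville_numbers) \<inter> cantor_set \<noteq> {}"
proof
  have "(\<lambda>N. (real N - 4) / (2 * real N + 2)) \<longlonglongrightarrow> 1 / 2"
    by real_asymp
  then have "(\<lambda>N. (real N - 4) / (2 * real N + 2) * (ln 2 / ln 3)) \<longlonglongrightarrow> 1 / 2 * (ln 2 / ln 3)"
    by (rule tendsto_mult_right)
  then have "(\<lambda>N. ereal ((real N - 4) / (2 * real N + 2) * (ln 2 / ln 3)))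
      \<longlonglongrightarrow> ereal ((ln 2 / ln 3) / 2)"
    by (intro tendsto_ereal) (simp add: mult.commute)
  \<comment> \<open>The set does not depend on \<open>N\<close>, so the bounds for all
    \<open>N\<close> from 5 on pass to the limit.\<close>
  moreover have "\<exists>M. \<forall>N\<ge>M. ereal ((real N - 4) / (2 * real N + 2) * (ln 2 / ln 3))
      \<le> hausdorff_dim ((very_well_approximable - liouville_numbers) \<inter> cantor_set)"
    using blocks.exponent_le_hausdorff_dim blocks.exponent_def
    by (intro exI[of _ 5]) (auto simp: blocks_def)
  ultimately show "hausdorff_dim ((very_well_approximable - liouville_numbers) \<inter> cantor_set)
      \<ge> ereal ((ln 2 / ln 3) / 2)"
    by (rule LIMSEQ_le_const2)
next
  interpret blocks 5 by unfold_locales simp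
  show "(very_well_approximable - liouville_numbers) \<inter> cantor_set \<noteq> {}"
    using point_in_set[of 0] by blast
qed

end
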